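(* Let $\|\cdot\|$ be a norm on $\mathbb{R}^d$ and $\epsilon\ge 0$. Let $\mu$ and $\nu$ be finite positive measures on $\mathbb{R}^d$ with $\mu(\mathbb{R}^d)=\nu(\mathbb{R}^d)$, both absolutely continuous with respect to Lebesgue measure and with bounded supports. Then $D_\epsilon(\mu,\nu)=0$ if and only if $W_\infty(\mu,\nu)\le 2\epsilon$.
   Context: $\Pi(\mu,\nu)$ is the set of measures on $\mathbb{R}^d\times\mathbb{R}^d$ with marginals $\mu$ and $\nu$, and $D_\epsilon(\mu,\nu)=\inf_{\pi\in\Pi(\mu,\nu)}\pi\big(\{(x,x'):\|x-x'\|>2\epsilon\}\big)$. $W_p(\mu,\nu)=\big(\inf_{\pi\in\Pi(\mu,\nu)}\int\|x-x'\|^p\,d\pi\big)^{1/p}$ and $W_\infty(\mu,\nu)=\lim_{p\to\infty}W_p(\mu,\nu)$. *)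

theory Defs
  imports "HOL-Analysis.Analysis"
begin

definition is_norm :: "('a::real_vector \<Rightarrow> real) \<Rightarrow> bool" where
  "is_norm N \<longleftrightarrow> (\<forall>x. N x = 0 \<longleftrightarrow> x = 0) \<and> (\<forall>x y. N (x + y) \<le> N x + N y)
     \<and> (\<forall>c x. N (c *\<^sub>R x) = \<bar>c\<bar> * N x)"

definition measure_support :: "'a::metric_space measure \<Rightarrow> 'a set" where
  "measure_support \<mu> = {x. \<forall>e>0. emeasure \<mu> (ball x e) \<noteq> 0}"

definition couplings :: "'a::euclidean_space measure \<Rightarrow> 'a measure \<Rightarrow> ('a \<times> 'a) measure set" where
  "couplings \<mu> \<nu> = {\<pi>. sets \<pi> = sets (borel :: ('a \<times> 'a) measure)
       \<and> distr \<pi> borel fst = \<mu> \<and> distr \<pi> borel snd = \<nu>}"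

definition D_eps :: "('a::euclidean_space \<Rightarrow> real) \<Rightarrow> real \<Rightarrow> 'a measure \<Rightarrow> 'a measure \<Rightarrow> ennreal" where
  "D_eps N \<epsilon> \<mu> \<nu> = (INF \<pi>\<in>couplings \<mu> \<nu>. emeasure \<pi> {z. N (fst z - snd z) > 2 * \<epsilon>})"

text \<open>p-Wasserstein distance (finite under the hypotheses of the theorem, hence enn2real).\<close>
definition W_p :: "('a::euclidean_space \<Rightarrow> real) \<Rightarrow> real \<Rightarrow> 'a measure \<Rightarrow> 'a measure \<Rightarrow> real" where
  "W_p N p \<mu> \<nu> = (enn2real (INF \<pi>\<in>couplings \<mu> \<nu>.
       \<integral>\<^sup>+ z. ennreal (N (fst z - snd z) powr p) \<partial>\<pi>)) powr (1 / p)"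

definition W_inf :: "('a::euclidean_space \<Rightarrow> real) \<Rightarrow> 'a measure \<Rightarrow> 'a measure \<Rightarrow> real" where
  "W_inf N \<mu> \<nu> = Lim at_top (\<lambda>p. W_p N p \<mu> \<nu>)"

end

theory Submission
  imports Defs
begin

text \<open>
  Let $g(t)$ be the infimum over all couplings $\pi$ of $\pi(N(x-x') > t)$, so that
  $D_\epsilon = g(2\epsilon)$, and let $t_0$ be the infimum of the zeros of the decreasing
  function $g$. Comparing $\int N^p\,d\pi$ with its parts on $N \le t$ and $N > t$ gives
  $W_p \le m^{1/p} t$ if $g(t) = 0$, where $m$ is the total mass, and
  $W_p \ge g(s)^{1/p} s$ for every $s \ge 0$; hence $W_p \to t_0$.
  It remains to see that $g(t_0) = 0$, which is compactness of the set of couplings: by Tychonoff,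
  a sequence of couplings has a pointwise cluster point among all set functions. It is only finitely
  additive, but its marginals are measures, so compact inner regularity of these allows one to
  extend its restriction to rectangles to a measure by Caratheodory's theorem.
\<close>

section \<open>Compactness of the set of couplings\<close>

text \<open>Tychonoff's theorem: all \<open>f n\<close> lie in the compact cube \<open>?K\<close>.
  The filter \<open>G\<close> takes the place of a subsequence, since for an uncountable index type
  such a cube need not be sequentially compact.\<close>

lemma bounded_family_pointwise_cluster:
  fixes f :: "nat \<Rightarrow> 'b \<Rightarrow> real"
  assumes bnd: "\<And>n S. \<bar>f n S\<bar> \<le> M"
  obtains m G where "G \<noteq> bot" "G \<le> sequentially" "\<And>S. ((\<lambda>n. f n S) \<longlongrightarrow> m S) G"
proof -
  let ?K = "PiE UNIV (\<lambda>_::'b. {-M..M})"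
  have "compactin (product_topology (\<lambda>_. euclidean) UNIV) ?K"
    by (subst compactin_PiE) auto
  then have K: "compact ?K"
    by (simp add: euclidean_product_topology)
  have "eventually (\<lambda>h. h \<in> ?K) (filtermap f sequentially)"
    using bnd by (auto simp: eventually_filtermap PiE_iff abs_le_iff minus_le_iff)
  moreover have "filtermap f sequentially \<noteq> bot"
    by (simp add: filtermap_bot_iff)
  ultimately obtain g where g: "inf (nhds g) (filtermap f sequentially) \<noteq> bot"
    using K unfolding compact_filter by blast
  \<comment> \<open>Pulls the cluster point \<open>g\<close> back to the indices. \<open>G\<close>
    is nontrivial because otherwise some neighbourhood of \<open>g\<close> would eventually be
    avoided by \<open>f n\<close>.\<close>
  define G where "G = inf sequentially (filtercomap f (nhds g))"
  have "G \<noteq> bot"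
  proof
    assume "G = bot"
    then have "eventually (\<lambda>_. False) G" by simp
    then obtain P Q where P: "eventually P sequentially" and Q: "eventually Q (nhds g)"
      and PQ: "\<And>n. P n \<Longrightarrow> Q (f n) \<Longrightarrow> False"
      unfolding G_def eventually_inf eventually_filtercomap by metis
    have "eventually (\<lambda>h. \<not> Q h) (filtermap f sequentially)"
      unfolding eventually_filtermap using P by eventually_elim (use PQ in blast)
    with Q have "eventually (\<lambda>_. False) (inf (nhds g) (filtermap f sequentially))"
      unfolding eventually_inf by blast
    with g show False by (simp add: eventually_False)
  qed
  moreover have "G \<le> sequentially" by (simp add: G_def)
  moreover have "((\<lambda>n. f n S) \<longlongrightarrow> g S) G" for S
  proof -
    have "filterlim f (nhds g) G"
      unfolding G_def by (metis filterlim_filtercomap filterlim_inf filterlim_mono inf_le2 order_refl)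
    then show ?thesis
    proof (intro topological_tendstoI)
      fix V :: "real set" assume V: "open V" "g S \<in> V" and lim: "filterlim f (nhds g) G"
      have "open ((\<lambda>h::'b \<Rightarrow> real. h S) -` V)"
        using V(1) by (intro open_vimage continuous_on_product_coordinates)
      then have "eventually (\<lambda>n. f n \<in> (\<lambda>h. h S) -` V) G"
        using lim V(2) by (intro topological_tendstoD) auto
      then show "eventually (\<lambda>n. f n S \<in> V) G" by simp
    qed
  qed
  ultimately show thesis using that by blast
qed

section \<open>Extending a content with regular marginals to a coupling\<close>

text \<open>Inner and outer regularity of a finite Borel measure, each used with half of the
  tolerance.\<close>

lemma finite_measure_compact_open_approx:
  fixes \<mu> :: "'a::euclidean_space measure"
  assumes "sets \<mu> = sets borel" "finite_measure \<mu>" "A \<in> sets borel" "0 < \<delta>"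
  obtains K U where "compact K" "open U" "K \<subseteq> A" "A \<subseteq> U" "measure \<mu> (U - K) < \<delta>"
proof -
  interpret finite_measure \<mu> by fact
  have sp: "emeasure \<mu> (space \<mu>) \<noteq> \<infinity>" by simp
  have e: "ennreal (measure \<mu> A) < ennreal (measure \<mu> A + \<delta> / 2)"
    using \<open>0 < \<delta>\<close> by (simp add: ennreal_less_iff)
  have "(INF U \<in> {U. A \<subseteq> U \<and> open U}. emeasure \<mu> U) < ennreal (measure \<mu> A + \<delta> / 2)"
    using outer_regular[OF assms(1) sp assms(3)] e by (simp add: emeasure_eq_measure)
  then obtain U where U: "A \<subseteq> U" "open U" "measure \<mu> U < measure \<mu> A + \<delta> / 2"
    unfolding INF_less_iff by (auto simp: emeasure_eq_measure ennreal_less_iff)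
  \<comment> \<open>Since \<open>ennreal\<close> truncates negative numbers to 0, the comparison
    with \<open>measure \<mu> A - \<delta> / 2\<close> makes sense only if this is nonnegative;
    otherwise the empty set is close enough.\<close>
  obtain K where K: "K \<subseteq> A" "compact K" "measure \<mu> A < measure \<mu> K + \<delta> / 2"
  proof (cases "measure \<mu> A < \<delta> / 2")
    case True
    show thesis by (rule that[of "{}"]) (use True in auto)
  next
    case False
    then have "ennreal (measure \<mu> A - \<delta> / 2) < ennreal (measure \<mu> A)"
      using \<open>0 < \<delta>\<close> by (simp add: ennreal_less_iff)
    then have "ennreal (measure \<mu> A - \<delta> / 2) < (SUP K \<in> {K. K \<subseteq> A \<and> compact K}. emeasure \<mu> K)"
      using inner_regular[OF assms(1) sp assms(3)] by (simp add: emeasure_eq_measure)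
    then obtain K where "K \<subseteq> A" "compact K" "measure \<mu> A - \<delta> / 2 < measure \<mu> K"
      unfolding less_SUP_iff using False by (auto simp: emeasure_eq_measure ennreal_less_iff)
    then show thesis by (intro that[of K]) auto
  qed
  have "U \<in> sets \<mu>" "K \<in> sets \<mu>"
    using U K assms(1) by (auto intro: borel_compact)
  then have "measure \<mu> (U - K) = measure \<mu> U - measure \<mu> K"
    using U K by (intro finite_measure_Diff) auto
  then show thesis using that[of K U] U K by auto
qed

lemma sigma_sets_eq_borel_prod:
  fixes R :: "('a::euclidean_space \<times> 'b::euclidean_space) set set"
  assumes R: "R \<subseteq> sets borel" and rect: "\<And>A B. A \<in> sets borel \<Longrightarrow> B \<in> sets borel \<Longrightarrow> A \<times> B \<in> R"
  shows "sigma_sets UNIV R = sets borel"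
proof
  show "sigma_sets UNIV R \<subseteq> sets borel"
    using sets.sigma_sets_subset[OF R] by simp
  have "sets (borel :: ('a \<times> 'b) measure) = sigma_sets UNIV {A \<times> B | A B. A \<in> sets borel \<and> B \<in> sets borel}"
    by (simp add: borel_prod[symmetric] sets_pair_measure)
  also have "\<dots> \<subseteq> sigma_sets UNIV R"
    by (rule sigma_sets_mono') (use rect in auto)
  finally show "sets borel \<subseteq> sigma_sets UNIV R" .
qed

text \<open>A pointwise limit of couplings is only finitely additive; what makes it extendable is
  that its marginals are genuine measures. The conclusion speaks of rectangles only, because on
  other Borel sets the extension may differ from \<open>m\<close>: mass can concentrate on a closed
  set in the limit.\<close>

lemma coupling_of_content:
  fixes m :: "('a::euclidean_space \<times> 'a) set \<Rightarrow> real" and \<mu> \<nu> :: "'a measure"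
  assumes sets: "sets \<mu> = sets borel" "sets \<nu> = sets borel"
    and fin: "finite_measure \<mu>" "finite_measure \<nu>"
    and nonneg: "\<And>S. 0 \<le> m S"
    and add: "\<And>S T. S \<in> sets borel \<Longrightarrow> T \<in> sets borel \<Longrightarrow> S \<inter> T = {} \<Longrightarrow> m (S \<union> T) = m S + m T"
    and marg1: "\<And>A. A \<in> sets borel \<Longrightarrow> m (A \<times> UNIV) = measure \<mu> A"
    and marg2: "\<And>B. B \<in> sets borel \<Longrightarrow> m (UNIV \<times> B) = measure \<nu> B"
  obtains \<pi> where "\<pi> \<in> couplings \<mu> \<nu>"
    "\<And>A B. A \<in> sets borel \<Longrightarrow> B \<in> sets borel \<Longrightarrow> emeasure \<pi> (A \<times> B) = ennreal (m (A \<times> B))"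
proof -
  interpret \<mu>: finite_measure \<mu> by fact
  interpret \<nu>: finite_measure \<nu> by fact
  have rectangle_borel: "A \<times> B \<in> sets borel" if "A \<in> sets borel" "B \<in> sets borel" for A B :: "'a set"
    using that by (rule borel_Times)
  have m_mono: "m S \<le> m T" if "S \<subseteq> T" "S \<in> sets borel" "T \<in> sets borel" for S T
  proof -
    have "m T = m S + m (T - S)"
      using add[of S "T - S"] that by (simp add: Un_absorb1)
    with nonneg[of "T - S"] show ?thesis by simp
  qed
  have m_Un: "m (S \<union> T) \<le> m S + m T" if "S \<in> sets borel" "T \<in> sets borel" for S T
  proof -
    have "m (S \<union> T) = m S + m (T - S)"
      using add[of S "T - S"] that by simp
    with m_mono[of "T - S" T] that show ?thesis by auto
  qed
  have m_empty: "m {} = 0" using add[of "{}" "{}"] by simp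
  have m_UN: "m (\<Union>i<n. S i) \<le> (\<Sum>i<n. m (S i))" if "\<And>i. S i \<in> sets borel" for n :: nat and S
  proof (induction n)
    case (Suc n)
    have "m (\<Union>i<Suc n. S i) \<le> m (\<Union>i<n. S i) + m (S n)"
      using m_Un[of "S n" "\<Union>i<n. S i"] that by (auto simp: lessThan_Suc add.commute)
    with Suc show ?case by simp
  qed (simp add: m_empty)

  \<comment> \<open>A finitely additive \<open>m\<close> is automatically countably additive on the ring of \<open>m\<close>-regular sets,
    and this ring contains the rectangles because the marginals of \<open>m\<close> are regular.\<close>
  define R where "R = {S \<in> sets borel. \<forall>\<delta>>0. \<exists>K U. compact K \<and> open U \<and> K \<subseteq> S \<and> S \<subseteq> U \<and> m (U - K) < \<delta>}"
  have R_borel: "S \<in> sets borel" if "S \<in> R" for S using that by (simp add: R_def)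
  have R_approx: "\<exists>K U. compact K \<and> open U \<and> K \<subseteq> S \<and> S \<subseteq> U \<and> m (U - K) < \<delta>"
    if "S \<in> R" "0 < \<delta>" for S \<delta> using that unfolding R_def by blast
  have rect: "A \<times> B \<in> R" if A: "A \<in> sets borel" and B: "B \<in> sets borel" for A B
  proof -
    have "\<exists>K U. compact K \<and> open U \<and> K \<subseteq> A \<times> B \<and> A \<times> B \<subseteq> U \<and> m (U - K) < \<delta>" if "\<delta> > 0" for \<delta>
    proof -
      have d: "0 < \<delta> / 2" using that by simp
      obtain K U where KU: "compact K" "open U" "K \<subseteq> A" "A \<subseteq> U" "measure \<mu> (U - K) < \<delta> / 2"
        by (rule finite_measure_compact_open_approx[OF sets(1) fin(1) A d])
      obtain L V where LV: "compact L" "open V" "L \<subseteq> B" "B \<subseteq> V" "measure \<nu> (V - L) < \<delta> / 2"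
        by (rule finite_measure_compact_open_approx[OF sets(2) fin(2) B d])
      have b: "K \<in> sets borel" "L \<in> sets borel" "U \<in> sets borel" "V \<in> sets borel"
        using KU LV by (auto intro: borel_compact)
      \<comment> \<open>A point of \<open>U \<times> V\<close> outside \<open>K \<times> L\<close>
        violates the inner approximation in one of its coordinates, so the error is controlled by
        the two marginals alone.\<close>
      have "m (U \<times> V - K \<times> L) \<le> m ((U - K) \<times> UNIV \<union> UNIV \<times> (V - L))"
        by (rule m_mono) (use b in \<open>auto intro!: sets.Diff sets.Un rectangle_borel\<close>)
      also have "\<dots> \<le> m ((U - K) \<times> UNIV) + m (UNIV \<times> (V - L))"
        by (rule m_Un) (use b in \<open>auto intro!: rectangle_borel\<close>)
      also have "\<dots> < \<delta>" using KU LV b by (simp add: marg1 marg2)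
      finally show ?thesis
        using KU LV by (intro exI[of _ "K \<times> L"] exI[of _ "U \<times> V"])
          (auto intro!: compact_Times open_Times)
    qed
    then show ?thesis using A B by (auto simp: R_def intro: rectangle_borel)
  qed
  have approx2: "\<exists>K U L V. compact K \<and> open U \<and> K \<subseteq> S \<and> S \<subseteq> U \<and> compact L \<and> open V \<and> L \<subseteq> T \<and> T \<subseteq> V
      \<and> m ((U - K) \<union> (V - L)) < \<delta>" if "S \<in> R" "T \<in> R" "0 < \<delta>" for S T \<delta>
  proof -
    obtain K U where KU: "compact K" "open U" "K \<subseteq> S" "S \<subseteq> U" "m (U - K) < \<delta> / 2"
      using R_approx[OF \<open>S \<in> R\<close>, of "\<delta> / 2"] \<open>0 < \<delta>\<close> by auto
    obtain L V where LV: "compact L" "open V" "L \<subseteq> T" "T \<subseteq> V" "m (V - L) < \<delta> / 2"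
      using R_approx[OF \<open>T \<in> R\<close>, of "\<delta> / 2"] \<open>0 < \<delta>\<close> by auto
    have "m ((U - K) \<union> (V - L)) \<le> m (U - K) + m (V - L)"
      by (rule m_Un) (use KU LV in \<open>auto intro: sets.Diff borel_open borel_compact\<close>)
    also have "\<dots> < \<delta>" using KU(5) LV(5) by simp
    finally show ?thesis using KU(1-4) LV(1-4) by blast
  qed
  have R_ring: "ring_of_sets UNIV R"
    unfolding ring_of_sets_iff
  proof (intro conjI ballI)
    show "{} \<in> R" using rect[of "{}" "{}"] by simp
    fix S T assume ST: "S \<in> R" "T \<in> R"
    show "S \<union> T \<in> R" unfolding R_def
    proof (intro CollectI conjI allI impI)
      fix \<delta> :: real assume "0 < \<delta>"
      from approx2[OF ST this] obtain K U L V where *: "compact K" "open U" "K \<subseteq> S" "S \<subseteq> U"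
        "compact L" "open V" "L \<subseteq> T" "T \<subseteq> V" "m ((U - K) \<union> (V - L)) < \<delta>" by blast
      have "m ((U \<union> V) - (K \<union> L)) \<le> m ((U - K) \<union> (V - L))"
        by (rule m_mono)
          (use * in \<open>auto intro: sets.Diff sets.Un borel_open borel_compact\<close>)
      with * show "\<exists>K U. compact K \<and> open U \<and> K \<subseteq> S \<union> T \<and> S \<union> T \<subseteq> U \<and> m (U - K) < \<delta>"
        by (intro exI[of _ "K \<union> L"] exI[of _ "U \<union> V"]) auto
    qed (use ST R_borel in auto)
    show "S - T \<in> R" unfolding R_def
    proof (intro CollectI conjI allI impI)
      fix \<delta> :: real assume "0 < \<delta>"
      from approx2[OF ST this] obtain K U L V where *: "compact K" "open U" "K \<subseteq> S" "S \<subseteq> U"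
        "compact L" "open V" "L \<subseteq> T" "T \<subseteq> V" "m ((U - K) \<union> (V - L)) < \<delta>" by blast
      \<comment> \<open>In the subtracted set the roles are exchanged: removing the open
        \<open>V\<close> keeps \<open>K\<close> compact, and removing the compact \<open>L\<close>
        keeps \<open>U\<close> open.\<close>
      have "m ((U - L) - (K - V)) \<le> m ((U - K) \<union> (V - L))"
        by (rule m_mono)
          (use * in \<open>auto intro: sets.Diff sets.Un borel_open borel_compact\<close>)
      with * show "\<exists>K U. compact K \<and> open U \<and> K \<subseteq> S - T \<and> S - T \<subseteq> U \<and> m (U - K) < \<delta>"
        by (intro exI[of _ "K - V"] exI[of _ "U - L"])
          (auto intro!: compact_diff open_Diff compact_imp_closed)
    qed (use ST R_borel in auto)
  qed auto
  interpret R: ring_of_sets UNIV R by (rule R_ring)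

  \<comment> \<open>Continuity at the empty set, the condition in Caratheodory's theorem. Each
    \<open>A i\<close> is approximated from inside by a compact \<open>K i\<close>, with errors that
    sum to less than \<open>\<delta>\<close>. The \<open>K i\<close> need not decrease, so the
    nested compactness argument is applied to their finite intersections.\<close>
  have cont: "(\<lambda>i. ennreal (m (A i))) \<longlonglongrightarrow> 0"
    if A: "range A \<subseteq> R" "decseq A" "(\<Inter>i. A i) = {}" for A
  proof -
    have AR: "A i \<in> R" for i using A(1) by auto
    note Ab = R_borel[OF AR]
    have "(\<lambda>i. m (A i)) \<longlonglongrightarrow> 0"
    proof (rule LIMSEQ_I)
      fix \<delta> :: real assume \<delta>: "0 < \<delta>"
      have "\<exists>K. compact K \<and> K \<subseteq> A i \<and> m (A i - K) < \<delta> * (1/2) ^ Suc i" for i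
      proof -
        have "0 < \<delta> * (1/2) ^ Suc i" using \<delta> by simp
        from R_approx[OF AR[of i] this] obtain K U where *: "compact K" "open U" "K \<subseteq> A i" "A i \<subseteq> U"
          "m (U - K) < \<delta> * (1/2) ^ Suc i" by blast
        have "m (A i - K) \<le> m (U - K)"
          by (rule m_mono) (use * Ab[of i] in \<open>auto intro: sets.Diff borel_open borel_compact\<close>)
        with * show ?thesis by (intro exI[of _ K]) auto
      qed
      then obtain K where K: "\<And>i. compact (K i)" "\<And>i. K i \<subseteq> A i"
        "\<And>i. m (A i - K i) < \<delta> * (1/2) ^ Suc i" by metis
      have Kb: "K i \<in> sets borel" for i using K(1) by (auto intro: borel_compact)
      have "\<exists>n. (\<Inter>i\<le>n. K i) = {}"
      proof (rule ccontr)
        assume "\<nexists>n. (\<Inter>i\<le>n. K i) = {}"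
        then have "\<Inter>(range (\<lambda>n. \<Inter>i\<le>n. K i)) \<noteq> {}"
          using K(1) by (intro compact_nest) (auto intro!: compact_Inter)
        then obtain x where "\<And>n. x \<in> (\<Inter>i\<le>n. K i)" by auto
        then have "x \<in> (\<Inter>i. A i)" using K(2) by fastforce
        with A(3) show False by simp
      qed
      then obtain n where n: "(\<Inter>i\<le>n. K i) = {}" by blast
      have "norm (m (A k) - 0) < \<delta>" if "n \<le> k" for k
      proof -
        \<comment> \<open>A point of \<open>A k\<close> lies in every earlier \<open>A i\<close> but
          misses some \<open>K i\<close> with \<open>i \<le> n\<close>, hence falls into one of
          finitely many error sets.\<close>
        have "A k \<subseteq> (\<Union>i<Suc n. A i - K i)"
        proof
          fix x assume x: "x \<in> A k"
          obtain i where i: "i \<le> n" "x \<notin> K i" using n by auto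
          then have "x \<in> A i" using x decseqD[OF A(2), of i k] \<open>n \<le> k\<close> by auto
          with i show "x \<in> (\<Union>i<Suc n. A i - K i)" by auto
        qed
        then have "m (A k) \<le> m (\<Union>i<Suc n. A i - K i)"
          by (rule m_mono) (use Ab Kb in auto)
        also have "\<dots> \<le> (\<Sum>i<Suc n. m (A i - K i))"
          by (rule m_UN) (use Ab Kb in auto)
        also have "\<dots> < (\<Sum>i<Suc n. \<delta> * (1/2) ^ Suc i)"
          by (rule sum_strict_mono) (use K in auto)
        also have "\<dots> = \<delta> * (1 - (1/2) ^ Suc n)"
          by (induction n) (auto simp: algebra_simps)
        also have "\<dots> \<le> \<delta>" using \<delta> by (simp add: algebra_simps)
        finally show ?thesis using nonneg[of "A k"] by simp
      qed
      then show "\<exists>n. \<forall>k\<ge>n. norm (m (A k) - 0) < \<delta>" by blast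
    qed
    then show ?thesis using tendsto_ennrealI by fastforce
  qed
  have "\<exists>\<rho> :: ('a \<times> 'a) set \<Rightarrow> ennreal. (\<forall>s\<in>R. \<rho> s = ennreal (m s)) \<and> measure_space UNIV (sigma_sets UNIV R) \<rho>"
  proof (rule R.caratheodory_empty_continuous)
    show "positive R (\<lambda>s. ennreal (m s))" by (simp add: positive_def m_empty)
    show "additive R (\<lambda>s. ennreal (m s))"
      using add R_borel nonneg by (simp add: additive_def ennreal_plus[symmetric] del: ennreal_plus)
  qed (use cont in auto)
  moreover have sig: "sigma_sets UNIV R = sets borel"
    by (rule sigma_sets_eq_borel_prod) (use R_borel rect in auto)
  ultimately obtain \<rho> where \<rho>: "\<And>S. S \<in> R \<Longrightarrow> \<rho> S = ennreal (m S)" "measure_space UNIV (sets borel) \<rho>"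
    by auto
  define \<pi> where "\<pi> = measure_of UNIV (sets borel) \<rho>"
  have sets_\<pi>: "sets \<pi> = sets borel"
    unfolding \<pi>_def by (metis sets_measure_of sets.sigma_sets_eq space_borel subset_UNIV Pow_UNIV)
  have em: "emeasure \<pi> S = \<rho> S" if "S \<in> sets borel" for S
    unfolding \<pi>_def using \<rho>(2) that
    by (intro emeasure_measure_of_sigma) (auto simp: measure_space_def)
  have rect_\<pi>: "emeasure \<pi> (A \<times> B) = ennreal (m (A \<times> B))"
    if "A \<in> sets borel" "B \<in> sets borel" for A B
    using that by (simp add: em rectangle_borel \<rho>(1) rect)
  have sp: "space \<pi> = UNIV" using sets_eq_imp_space_eq[OF sets_\<pi>] by simp
  have mfst: "fst \<in> measurable \<pi> borel" and msnd: "snd \<in> measurable \<pi> borel"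
    using sets_\<pi> by (auto simp: measurable_cong_sets[OF sets_\<pi> refl] intro!: borel_measurable_continuous_onI continuous_intros)
  have "distr \<pi> borel fst = \<mu>"
  proof (rule measure_eqI)
    fix A assume "A \<in> sets (distr \<pi> borel fst)"
    then have A: "A \<in> sets borel" by simp
    have "emeasure (distr \<pi> borel fst) A = emeasure \<pi> (A \<times> UNIV)"
      using A by (subst emeasure_distr[OF mfst]) (auto simp: sp intro!: arg_cong[where f="emeasure \<pi>"])
    then show "emeasure (distr \<pi> borel fst) A = emeasure \<mu> A"
      using A by (simp add: rect_\<pi> marg1 \<mu>.emeasure_eq_measure)
  qed (simp add: sets)
  moreover have "distr \<pi> borel snd = \<nu>"
  proof (rule measure_eqI)
    fix A assume "A \<in> sets (distr \<pi> borel snd)"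
    then have A: "A \<in> sets borel" by simp
    have "emeasure (distr \<pi> borel snd) A = emeasure \<pi> (UNIV \<times> A)"
      using A by (subst emeasure_distr[OF msnd]) (auto simp: sp intro!: arg_cong[where f="emeasure \<pi>"])
    then show "emeasure (distr \<pi> borel snd) A = emeasure \<nu> A"
      using A by (simp add: rect_\<pi> marg2 \<nu>.emeasure_eq_measure)
  qed (simp add: sets)
  ultimately have "\<pi> \<in> couplings \<mu> \<nu>" by (simp add: couplings_def sets_\<pi>)
  with rect_\<pi> show thesis using that by blast
qed

section \<open>Marginals and limits of couplings\<close>

lemma couplings_fst:
  assumes "\<pi> \<in> couplings \<mu> \<nu>" "A \<in> sets borel"
  shows "emeasure \<pi> (A \<times> UNIV) = emeasure \<mu> A"
proof -
  have s: "sets \<pi> = sets borel" and d: "distr \<pi> borel fst = \<mu>" using assms(1) by (auto simp: couplings_def)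
  have m: "fst \<in> measurable \<pi> borel"
    by (auto simp: measurable_cong_sets[OF s refl] intro!: borel_measurable_continuous_onI continuous_intros)
  have "emeasure \<mu> A = emeasure \<pi> (fst -` A \<inter> space \<pi>)"
    unfolding d[symmetric] using m assms(2) by (rule emeasure_distr)
  also have "fst -` A \<inter> space \<pi> = A \<times> UNIV"
    using sets_eq_imp_space_eq[OF s] by auto
  finally show ?thesis by simp
qed

lemma couplings_snd:
  assumes "\<pi> \<in> couplings \<mu> \<nu>" "B \<in> sets borel"
  shows "emeasure \<pi> (UNIV \<times> B) = emeasure \<nu> B"
proof -
  have s: "sets \<pi> = sets borel" and d: "distr \<pi> borel snd = \<nu>" using assms(1) by (auto simp: couplings_def)
  have m: "snd \<in> measurable \<pi> borel"
    by (auto simp: measurable_cong_sets[OF s refl] intro!: borel_measurable_continuous_onI continuous_intros)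
  have "emeasure \<nu> B = emeasure \<pi> (snd -` B \<inter> space \<pi>)"
    unfolding d[symmetric] using m assms(2) by (rule emeasure_distr)
  also have "snd -` B \<inter> space \<pi> = UNIV \<times> B"
    using sets_eq_imp_space_eq[OF s] by auto
  finally show ?thesis by simp
qed

lemma couplings_UNIV: "\<pi> \<in> couplings \<mu> \<nu> \<Longrightarrow> emeasure \<pi> UNIV = emeasure \<mu> UNIV"
  using couplings_fst[of \<pi> \<mu> \<nu> UNIV] by simp

text \<open>The form of weak compactness used for \<open>gap_critical\<close>: a cluster point of
  couplings is again a coupling, as the marginals do not change with \<open>n\<close>, and it gives
  no mass to an open set whose mass vanishes in the limit, as in the portmanteau theorem.\<close>

lemma couplings_cluster:
  fixes \<mu> \<nu> :: "'a::euclidean_space measure"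
  assumes sets: "sets \<mu> = sets borel" "sets \<nu> = sets borel"
    and fin: "finite_measure \<mu>" "finite_measure \<nu>"
    and \<pi>: "\<And>n. \<pi> n \<in> couplings \<mu> \<nu>"
  shows "\<exists>\<rho>\<in>couplings \<mu> \<nu>. \<forall>U. open U \<longrightarrow> (\<lambda>n. emeasure (\<pi> n) U) \<longlonglongrightarrow> 0 \<longrightarrow> emeasure \<rho> U = 0"
proof -
  interpret \<mu>: finite_measure \<mu> by fact
  interpret \<nu>: finite_measure \<nu> by fact
  have sp: "space \<mu> = UNIV" using sets_eq_imp_space_eq[OF sets(1)] by simp
  have s\<pi>: "sets (\<pi> n) = sets borel" for n using \<pi>[of n] by (simp add: couplings_def)
  have sp\<pi>: "space (\<pi> n) = UNIV" for n using sets_eq_imp_space_eq[OF s\<pi>] by simp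
  have fin\<pi>: "finite_measure (\<pi> n)" for n
    by (rule finite_measureI) (use couplings_UNIV[OF \<pi>[of n]] \<mu>.emeasure_finite[of UNIV] in \<open>simp add: sp\<pi>\<close>)
  have "\<bar>measure (\<pi> n) S\<bar> \<le> measure \<mu> UNIV" for n S
    using finite_measure.bounded_measure[OF fin\<pi>, of n S] couplings_UNIV[OF \<pi>[of n]]
    by (simp add: sp\<pi> measure_def)
  then obtain m G where G: "G \<noteq> bot" "G \<le> sequentially"
    and m: "\<And>S. ((\<lambda>n. measure (\<pi> n) S) \<longlongrightarrow> m S) G"
    by (rule bounded_family_pointwise_cluster[where f="\<lambda>n. measure (\<pi> n)"]) auto
  have nonneg: "0 \<le> m S" for S
    by (rule tendsto_lowerbound[OF m]) (use G in auto)
  have add: "m (S \<union> T) = m S + m T" if "S \<in> sets borel" "T \<in> sets borel" "S \<inter> T = {}" for S T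
  proof (rule tendsto_unique[OF G(1) m])
    have "measure (\<pi> n) (S \<union> T) = measure (\<pi> n) S + measure (\<pi> n) T" for n
      using finite_measure.finite_measure_Union[OF fin\<pi>] that s\<pi> by auto
    then show "((\<lambda>n. measure (\<pi> n) (S \<union> T)) \<longlongrightarrow> m S + m T) G"
      by (simp add: tendsto_add m)
  qed
  have marg1: "m (A \<times> UNIV) = measure \<mu> A" if "A \<in> sets borel" for A
    by (rule tendsto_unique[OF G(1) m]) (simp add: measure_def couplings_fst[OF \<pi> that])
  have marg2: "m (UNIV \<times> B) = measure \<nu> B" if "B \<in> sets borel" for B
    by (rule tendsto_unique[OF G(1) m]) (simp add: measure_def couplings_snd[OF \<pi> that])
  obtain \<rho> where \<rho>: "\<rho> \<in> couplings \<mu> \<nu>"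
    "\<And>A B. A \<in> sets borel \<Longrightarrow> B \<in> sets borel \<Longrightarrow> emeasure \<rho> (A \<times> B) = ennreal (m (A \<times> B))"
    using coupling_of_content[OF sets fin nonneg add marg1 marg2] by blast
  have s\<rho>: "sets \<rho> = sets borel" using \<rho>(1) by (simp add: couplings_def)
  have "emeasure \<rho> U = 0" if U: "open U" and lim: "(\<lambda>n. emeasure (\<pi> n) U) \<longlonglongrightarrow> 0" for U
  proof -
    \<comment> \<open>\<open>\<rho>\<close> is known to agree with the limit \<open>m\<close> on
      rectangles only. So \<open>U\<close> is exhausted by open rectangles, each null by
      monotonicity, and Lindelof's theorem leaves countably many of them.\<close>
    define \<F> where "\<F> = {A \<times> B | A B. open A \<and> open B \<and> A \<times> B \<subseteq> U}"
    have UF: "\<Union>\<F> = U"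
    proof
      show "U \<subseteq> \<Union>\<F>"
      proof
        fix z assume "z \<in> U"
        with U obtain A B where "open A" "open B" "z \<in> A \<times> B" "A \<times> B \<subseteq> U"
          by (rule open_prod_elim)
        then show "z \<in> \<Union>\<F>" unfolding \<F>_def by blast
      qed
    qed (auto simp: \<F>_def)
    have null: "S \<in> null_sets \<rho>" if "S \<in> \<F>" for S
    proof -
      obtain A B where S: "S = A \<times> B" "open A" "open B" "A \<times> B \<subseteq> U"
        using \<open>S \<in> \<F>\<close> unfolding \<F>_def by blast
      have bS: "S \<in> sets borel" unfolding S(1) using S(2,3) by (intro borel_open open_Times)
      have "(\<lambda>n. measure (\<pi> n) U) \<longlonglongrightarrow> 0"
        using tendsto_enn2real[of _ 0, simplified, OF lim] by (simp add: measure_def)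
      moreover have "norm (measure (\<pi> n) S) \<le> measure (\<pi> n) U" for n
        using finite_measure.finite_measure_mono[OF fin\<pi>, of S U n] S U s\<pi>[of n] by auto
      ultimately have "(\<lambda>n. measure (\<pi> n) S) \<longlonglongrightarrow> 0"
        by (metis (no_types, lifting) Lim_null_comparison always_eventually)
      then have "((\<lambda>n. measure (\<pi> n) S) \<longlongrightarrow> 0) G"
        by (rule tendsto_mono[OF G(2)])
      then have "m S = 0" using tendsto_unique[OF G(1) m] by blast
      then show ?thesis using \<rho>(2)[of A B] S bS s\<rho> by (auto simp: null_sets_def)
    qed
    have "\<And>S. S \<in> \<F> \<Longrightarrow> open S" by (auto simp: \<F>_def intro: open_Times)
    then obtain \<F>' where F': "\<F>' \<subseteq> \<F>" "countable \<F>'" "\<Union>\<F>' = \<Union>\<F>" by (rule Lindelof)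
    have "(\<Union>S\<in>\<F>'. S) \<in> null_sets \<rho>"
      by (rule null_sets_UN') (use F' null in auto)
    then show ?thesis using F'(3) UF by (auto simp: null_sets_def)
  qed
  with \<rho>(1) show ?thesis by blast
qed

section \<open>The limit of the Wasserstein distances\<close>

lemma is_norm_nonneg:
  assumes "is_norm N" shows "0 \<le> N x"
proof -
  have "N 0 = 0" "N (x + - x) \<le> N x + N (- x)" "N ((-1) *\<^sub>R x) = \<bar>-1\<bar> * N x"
    using assms unfolding is_norm_def by blast+
  then show ?thesis by simp
qed

text \<open>Expand \<open>x\<close> in the standard basis, whose coefficients are at most
  \<open>norm x\<close> in absolute value; \<open>C\<close> is the sum of the norms of the basis
  vectors.\<close>

lemma is_norm_bounded:
  fixes N :: "'a::euclidean_space \<Rightarrow> real"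
  assumes "is_norm N"
  shows "\<exists>C\<ge>0. \<forall>x. N x \<le> C * norm x"
proof -
  have N0: "N 0 = 0" and tri: "N (x + y) \<le> N x + N y" and hom: "N (c *\<^sub>R x) = \<bar>c\<bar> * N x" for x y c
    using assms unfolding is_norm_def by blast+
  have Nsum: "N (sum f A) \<le> (\<Sum>b\<in>A. N (f b))" if "finite A" for f and A :: "'a set"
    using that
  proof induction
    case (insert b A)
    then show ?case using tri[of "f b" "sum f A"] by simp
  qed (simp add: N0)
  define C where "C = (\<Sum>b\<in>(Basis::'a set). N b)"
  have "0 \<le> C" unfolding C_def by (intro sum_nonneg is_norm_nonneg assms)
  moreover have "N x \<le> C * norm x" for x
  proof -
    have "N x = N (\<Sum>b\<in>Basis. (x \<bullet> b) *\<^sub>R b)" by (simp add: euclidean_representation)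
    also have "\<dots> \<le> (\<Sum>b\<in>Basis. \<bar>x \<bullet> b\<bar> * N b)"
      using Nsum[of Basis "\<lambda>b. (x \<bullet> b) *\<^sub>R b"] by (simp add: hom)
    also have "\<dots> \<le> (\<Sum>b\<in>Basis. norm x * N b)"
      by (intro sum_mono mult_right_mono is_norm_nonneg assms Basis_le_norm)
    also have "\<dots> = C * norm x"
      unfolding C_def sum_distrib_right by (simp only: mult.commute)
    finally show ?thesis .
  qed
  ultimately show ?thesis by blast
qed

text \<open>The triangle inequality and the comparison with the Euclidean norm make \<open>N\<close>
  Lipschitz. Continuity is what makes the sets where \<open>N\<close> exceeds a threshold
  open.\<close>

lemma is_norm_continuous_on:
  fixes N :: "'a::euclidean_space \<Rightarrow> real"
  assumes "is_norm N"
  shows "continuous_on UNIV N"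
proof -
  obtain C where C: "0 \<le> C" "\<And>x. N x \<le> C * norm x"
    using is_norm_bounded[OF assms] by blast
  have tri: "N (x + y) \<le> N x + N y" for x y using assms unfolding is_norm_def by blast
  have "\<bar>N x - N y\<bar> \<le> C * norm (x - y)" for x y
    using tri[of y "x - y"] tri[of x "y - x"] C(2)[of "x - y"] C(2)[of "y - x"]
    by (simp add: norm_minus_commute)
  then have "C-lipschitz_on UNIV N"
    using C(1) by (intro lipschitz_onI) (auto simp: dist_norm)
  then show ?thesis by (rule lipschitz_on_continuous_on)
qed

text \<open>The complement of the support is the union of all open null sets, and by Lindelof's
  theorem countably many of them suffice.\<close>

lemma null_sets_Compl_measure_support:
  fixes \<mu> :: "'a::euclidean_space measure"
  assumes "sets \<mu> = sets borel"
  shows "- measure_support \<mu> \<in> null_sets \<mu>"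
proof -
  define \<F> where "\<F> = {U. open U \<and> emeasure \<mu> U = 0}"
  have "\<And>U. U \<in> \<F> \<Longrightarrow> open U" by (simp add: \<F>_def)
  then obtain \<F>' where F': "\<F>' \<subseteq> \<F>" "countable \<F>'" "\<Union>\<F>' = \<Union>\<F>" by (rule Lindelof)
  have null: "U \<in> null_sets \<mu>" if "U \<in> \<F>" for U
    using that assms by (auto simp: \<F>_def null_sets_def)
  have "(\<Union>U\<in>\<F>'. U) \<in> null_sets \<mu>"
    by (rule null_sets_UN') (use F' null in auto)
  moreover have "\<Union>\<F> = - measure_support \<mu>"
  proof
    show "- measure_support \<mu> \<subseteq> \<Union>\<F>"
    proof
      fix x assume "x \<in> - measure_support \<mu>"
      then obtain e where "e > 0" "emeasure \<mu> (ball x e) = 0" by (auto simp: measure_support_def)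
      then show "x \<in> \<Union>\<F>" by (auto simp: \<F>_def intro!: exI[of _ "ball x e"])
    qed
    show "\<Union>\<F> \<subseteq> - measure_support \<mu>"
    proof
      fix x assume "x \<in> \<Union>\<F>"
      then obtain U where U: "open U" "emeasure \<mu> U = 0" "x \<in> U" by (auto simp: \<F>_def)
      then obtain e where e: "e > 0" "ball x e \<subseteq> U" by (meson openE)
      have "emeasure \<mu> (ball x e) \<le> emeasure \<mu> U"
        using e U assms by (intro emeasure_mono) auto
      with e U show "x \<in> - measure_support \<mu>" by (auto simp: measure_support_def intro!: exI[of _ e])
    qed
  qed
  ultimately show ?thesis using F'(3) by simp
qed

text \<open>For positive mass, the product measure divided by the common mass is a coupling. Over an
  empty set of couplings the infima in \<open>D_eps\<close> and \<open>W_p\<close> would be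
  \<open>top\<close>.\<close>

lemma couplings_nonempty:
  fixes \<mu> \<nu> :: "'a::euclidean_space measure"
  assumes sets: "sets \<mu> = sets borel" "sets \<nu> = sets borel"
    and fin: "finite_measure \<mu>" "finite_measure \<nu>"
    and eq: "emeasure \<mu> UNIV = emeasure \<nu> UNIV"
  shows "couplings \<mu> \<nu> \<noteq> {}"
proof -
  interpret \<mu>: finite_measure \<mu> by fact
  interpret \<nu>: finite_measure \<nu> by fact
  define M where "M = measure \<mu> UNIV"
  have M: "0 \<le> M" "measure \<nu> UNIV = M" using eq by (auto simp: M_def measure_def)
  \<comment> \<open>For \<open>M = 0\<close> the junk value \<open>x / 0 = 0\<close> gives the correct coupling.\<close>
  define m where "m S = measure (\<mu> \<Otimes>\<^sub>M \<nu>) S / M" for S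
  interpret P: finite_measure "\<mu> \<Otimes>\<^sub>M \<nu>"
    using fin by (intro finite_measure_pair_measure)
  have sP: "sets (\<mu> \<Otimes>\<^sub>M \<nu>) = sets borel"
    using sets_pair_measure_cong[OF sets] by (metis borel_prod)
  have rect: "measure (\<mu> \<Otimes>\<^sub>M \<nu>) (A \<times> B) = measure \<mu> A * measure \<nu> B"
    if "A \<in> sets borel" "B \<in> sets borel" for A B
    using that by (simp add: measure_def \<nu>.emeasure_pair_measure_Times sets enn2real_mult)
  have zero: "measure \<mu> A = 0" "measure \<nu> A = 0" if "M = 0" "A \<in> sets borel" for A
    using that \<mu>.finite_measure_mono[of A UNIV] \<nu>.finite_measure_mono[of A UNIV] M sets
    by (auto simp: M_def measure_nonneg antisym)
  obtain \<pi> where "\<pi> \<in> couplings \<mu> \<nu>"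
  proof (rule coupling_of_content[OF sets fin, of m])
    show "0 \<le> m S" for S by (simp add: m_def M)
    show "m (S \<union> T) = m S + m T" if "S \<in> sets borel" "T \<in> sets borel" "S \<inter> T = {}" for S T
      using that P.finite_measure_Union[of S T] by (simp add: m_def sP add_divide_distrib)
    show "m (A \<times> UNIV) = measure \<mu> A" if "A \<in> sets borel" for A
      using rect[OF that, of UNIV] zero[OF _ that] M by (cases "M = 0") (auto simp: m_def)
    show "m (UNIV \<times> A) = measure \<nu> A" if "A \<in> sets borel" for A
      using rect[OF _ that, of UNIV] zero[OF _ that] M by (cases "M = 0") (auto simp: m_def M_def)
  qed blast
  then show ?thesis by blast
qed

lemma powr_inverse_tendsto_1:
  fixes c :: real assumes "0 < c"
  shows "((\<lambda>p. c powr (1 / p)) \<longlongrightarrow> 1) at_top"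
proof -
  have "((\<lambda>p::real. 1 / p) \<longlongrightarrow> 0) at_top"
    using tendsto_inverse_0_at_top[OF filterlim_ident] by (simp add: inverse_eq_divide)
  from tendsto_powr[OF tendsto_const[of c] this] assms show ?thesis by simp
qed

section \<open>Transport cost and far mass under bounded supports\<close>

locale bounded_transport =
  fixes N :: "'a::euclidean_space \<Rightarrow> real" and \<mu> \<nu> :: "'a measure"
  assumes norm: "is_norm N"
    and sets: "sets \<mu> = sets borel" "sets \<nu> = sets borel"
    and fin: "finite_measure \<mu>" "finite_measure \<nu>"
    and mass: "emeasure \<mu> UNIV = emeasure \<nu> UNIV"
    and supp: "bounded (measure_support \<mu>)" "bounded (measure_support \<nu>)"
begin

definition cost :: "real \<Rightarrow> ennreal" where
  "cost p = (INF \<pi>\<in>couplings \<mu> \<nu>. \<integral>\<^sup>+ z. ennreal (N (fst z - snd z) powr p) \<partial>\<pi>)"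

definition gap :: "real \<Rightarrow> ennreal" where
  "gap t = (INF \<pi>\<in>couplings \<mu> \<nu>. emeasure \<pi> {z. N (fst z - snd z) > t})"

lemma D_eps_eq_gap: "D_eps N \<epsilon> \<mu> \<nu> = gap (2 * \<epsilon>)"
  by (simp add: D_eps_def gap_def)

lemma W_p_eq_cost: "W_p N p \<mu> \<nu> = enn2real (cost p) powr (1 / p)"
  by (simp add: W_p_def cost_def)

lemma N_nonneg: "0 \<le> N x"
  by (rule is_norm_nonneg[OF norm])

lemma N_continuous: "continuous_on UNIV (\<lambda>z::'a \<times> 'a. N (fst z - snd z))"
  by (rule continuous_on_compose2[OF is_norm_continuous_on[OF norm]]) (auto intro!: continuous_intros)

lemma open_far: "open {z::'a \<times> 'a. N (fst z - snd z) > t}"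
  by (rule open_Collect_less) (auto intro: N_continuous)

definition total_mass :: real where "total_mass = measure \<mu> UNIV"

lemma total_mass_nonneg: "0 \<le> total_mass" by (simp add: total_mass_def)

lemma coupling_sets: "\<pi> \<in> couplings \<mu> \<nu> \<Longrightarrow> sets \<pi> = sets borel"
  by (simp add: couplings_def)

lemma coupling_space: "\<pi> \<in> couplings \<mu> \<nu> \<Longrightarrow> space \<pi> = UNIV"
  using sets_eq_imp_space_eq[OF coupling_sets] by simp

lemma coupling_mass: "\<pi> \<in> couplings \<mu> \<nu> \<Longrightarrow> emeasure \<pi> UNIV = ennreal total_mass"
  using couplings_UNIV[of \<pi> \<mu> \<nu>] finite_measure.emeasure_eq_measure[OF fin(1)] by (simp add: total_mass_def)

lemma coupling_mass_le: "\<pi> \<in> couplings \<mu> \<nu> \<Longrightarrow> emeasure \<pi> S \<le> ennreal total_mass"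
  using emeasure_space[of \<pi> S] coupling_mass coupling_space by simp

lemma far_measurable: "\<pi> \<in> couplings \<mu> \<nu> \<Longrightarrow> {z. N (fst z - snd z) > t} \<in> sets \<pi>"
  by (simp add: coupling_sets borel_open open_far)

lemma gap_antimono: "s \<le> t \<Longrightarrow> gap t \<le> gap s"
  unfolding gap_def
proof (rule INF_mono)
  fix \<pi> assume "\<pi> \<in> couplings \<mu> \<nu>" "s \<le> t"
  then show "\<exists>\<rho>\<in>couplings \<mu> \<nu>. emeasure \<rho> {z. t < N (fst z - snd z)} \<le> emeasure \<pi> {z. s < N (fst z - snd z)}"
    by (intro bexI[of _ \<pi>] emeasure_mono far_measurable) auto
qed

text \<open>Under any coupling almost every pair has its coordinates in the two supports, so one
  \<open>R\<close> serves all couplings. It comes from radii \<open>a\<close> and \<open>b\<close>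
  of the supports and the comparison of \<open>N\<close> with the Euclidean norm; absolute values
  are taken because the radius of an empty support may be negative.\<close>

lemma ex_diameter: "\<exists>R\<ge>0. \<forall>\<pi>\<in>couplings \<mu> \<nu>. AE z in \<pi>. N (fst z - snd z) \<le> R"
proof -
  obtain C where C: "0 \<le> C" "\<And>x. N x \<le> C * norm x" using is_norm_bounded[OF norm] by blast
  obtain a where a: "\<And>x. x \<in> measure_support \<mu> \<Longrightarrow> norm x \<le> a" using supp(1) by (auto simp: bounded_iff)
  obtain b where b: "\<And>x. x \<in> measure_support \<nu> \<Longrightarrow> norm x \<le> b" using supp(2) by (auto simp: bounded_iff)
  \<comment> \<open>A finitely additive \<open>m\<close> is automatically countably additive on the ring of \<open>m\<close>-regular sets,
    and this ring contains the rectangles because the marginals of \<open>m\<close> are regular.\<close>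
  define R where "R = C * (\<bar>a\<bar> + \<bar>b\<bar>)"
  have "AE z in \<pi>. N (fst z - snd z) \<le> R" if \<pi>: "\<pi> \<in> couplings \<mu> \<nu>" for \<pi>
  proof -
    let ?A = "- measure_support \<mu>" and ?B = "- measure_support \<nu>"
    have A: "?A \<in> null_sets \<mu>" and B: "?B \<in> null_sets \<nu>"
      by (auto intro!: null_sets_Compl_measure_support sets)
    have b1: "?A \<in> sets borel" "?B \<in> sets borel" using A B sets by (auto simp: null_sets_def)
    have "?A \<times> UNIV \<in> null_sets \<pi>"
      using couplings_fst[OF \<pi> b1(1)] A b1 by (auto simp: null_sets_def coupling_sets[OF \<pi>] intro!: borel_Times)
    moreover have "UNIV \<times> ?B \<in> null_sets \<pi>"
      using couplings_snd[OF \<pi> b1(2)] B b1 by (auto simp: null_sets_def coupling_sets[OF \<pi>] intro!: borel_Times)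
    ultimately have "?A \<times> UNIV \<union> UNIV \<times> ?B \<in> null_sets \<pi>" by (rule null_sets.Un)
    then show ?thesis
    proof (rule AE_I')
      show "{z \<in> space \<pi>. \<not> N (fst z - snd z) \<le> R} \<subseteq> ?A \<times> UNIV \<union> UNIV \<times> ?B"
      proof
        fix z assume z: "z \<in> {z \<in> space \<pi>. \<not> N (fst z - snd z) \<le> R}"
        show "z \<in> ?A \<times> UNIV \<union> UNIV \<times> ?B"
        proof (rule ccontr)
          assume "z \<notin> ?A \<times> UNIV \<union> UNIV \<times> ?B"
          then have "norm (fst z) \<le> a" "norm (snd z) \<le> b" using a b by (cases z; auto)+
          then have "norm (fst z - snd z) \<le> \<bar>a\<bar> + \<bar>b\<bar>"
            using norm_triangle_ineq4[of "fst z" "snd z"] by linarith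
          then have "C * norm (fst z - snd z) \<le> R" unfolding R_def using C(1) by (rule mult_left_mono)
          with C(2)[of "fst z - snd z"] z show False by simp
        qed
      qed
    qed
  qed
  moreover have "0 \<le> R" using C by (simp add: R_def)
  ultimately show ?thesis by blast
qed

text \<open>Split the integral at \<open>t\<close>: beyond \<open>t\<close> the integrand is at most
  \<open>R powr p\<close>, with \<open>R\<close> independent of the coupling. As
  \<open>gap t\<close> is an infimum that might not be attained, couplings with small far mass are
  used and the bound is reached up to \<open>e\<close>.\<close>

lemma cost_le_of_gap:
  assumes "gap t = 0" "0 \<le> t" "0 < p"
  shows "cost p \<le> ennreal (total_mass * t powr p)"
proof -
  obtain R where R: "0 \<le> R" "\<And>\<pi>. \<pi> \<in> couplings \<mu> \<nu> \<Longrightarrow> AE z in \<pi>. N (fst z - snd z) \<le> R"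
    using ex_diameter by blast
  define Q where "Q = R powr p"
  have Q: "0 \<le> Q" by (simp add: Q_def)
  show ?thesis
  proof (rule ennreal_le_epsilon)
    fix e :: real assume e: "0 < e"
    \<comment> \<open>Chosen so that \<open>Q * \<delta> \<le> e\<close>; the added 1 covers
      \<open>Q = 0\<close>.\<close>
    define \<delta> where "\<delta> = e / (Q + 1)"
    have \<delta>: "0 < \<delta>" using e Q by (simp add: \<delta>_def)
    have "gap t < ennreal \<delta>" using assms(1) \<delta> by simp
    then obtain \<pi> where \<pi>: "\<pi> \<in> couplings \<mu> \<nu>" "emeasure \<pi> {z. N (fst z - snd z) > t} < ennreal \<delta>"
      unfolding gap_def INF_less_iff by blast
    let ?F = "{z::'a \<times> 'a. N (fst z - snd z) > t}"
    have F: "?F \<in> sets \<pi>" by (rule far_measurable[OF \<pi>(1)])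
    have "cost p \<le> (\<integral>\<^sup>+ z. ennreal (N (fst z - snd z) powr p) \<partial>\<pi>)"
      unfolding cost_def using \<pi>(1) by (rule INF_lower)
    also have "\<dots> \<le> (\<integral>\<^sup>+ z. ennreal (t powr p) + ennreal Q * indicator ?F z \<partial>\<pi>)"
    proof (rule nn_integral_mono_AE)
      show "AE z in \<pi>. ennreal (N (fst z - snd z) powr p) \<le> ennreal (t powr p) + ennreal Q * indicator ?F z"
        using R(2)[OF \<pi>(1)]
      proof eventually_elim
        case (elim z)
        show ?case
        proof (cases "z \<in> ?F")
          case True
          have "N (fst z - snd z) powr p \<le> Q"
            unfolding Q_def using elim assms N_nonneg by (intro powr_mono2) auto
          then have "ennreal (N (fst z - snd z) powr p) \<le> ennreal Q" by (rule ennreal_leI)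
          then show ?thesis using True by (simp add: add_increasing)
        next
          case False
          then have "N (fst z - snd z) powr p \<le> t powr p"
            using assms N_nonneg by (intro powr_mono2) auto
          then have "ennreal (N (fst z - snd z) powr p) \<le> ennreal (t powr p)" by (rule ennreal_leI)
          then show ?thesis using False by simp
        qed
      qed
    qed
    also have "\<dots> = ennreal (t powr p) * emeasure \<pi> (space \<pi>) + ennreal Q * emeasure \<pi> ?F"
      using F by (subst nn_integral_add) (auto simp: nn_integral_cmult_indicator)
    also have "\<dots> \<le> ennreal (t powr p) * ennreal total_mass + ennreal Q * ennreal \<delta>"
      using \<pi> by (intro add_mono mult_left_mono) (auto simp: coupling_mass coupling_space)
    also have "\<dots> = ennreal (total_mass * t powr p + Q * \<delta>)"
      using Q \<delta> total_mass_nonneg by (simp add: ennreal_mult[symmetric] ennreal_plus[symmetric] mult.commute del: ennreal_plus)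
    also have "\<dots> \<le> ennreal (total_mass * t powr p + e)"
    proof (rule ennreal_leI)
      have "Q * \<delta> \<le> (Q + 1) * \<delta>" using \<delta> by (simp add: mult_right_mono)
      also have "\<dots> = e" using Q by (simp add: \<delta>_def)
      finally show "total_mass * t powr p + Q * \<delta> \<le> total_mass * t powr p + e" by simp
    qed
    also have "\<dots> = ennreal (total_mass * t powr p) + ennreal e"
      using e total_mass_nonneg by (simp add: ennreal_plus[symmetric] del: ennreal_plus)
    finally show "cost p \<le> ennreal (total_mass * t powr p) + ennreal e" .
  qed
qed

text \<open>Markov's inequality for each coupling, then the infimum on both sides.\<close>

lemma cost_ge_gap:
  assumes "0 \<le> s" "0 < p"
  shows "ennreal (s powr p) * gap s \<le> cost p"
  unfolding cost_def
proof (rule INF_greatest)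
  fix \<pi> assume \<pi>: "\<pi> \<in> couplings \<mu> \<nu>"
  let ?F = "{z::'a \<times> 'a. N (fst z - snd z) > s}"
  have F: "?F \<in> sets \<pi>" by (rule far_measurable[OF \<pi>])
  have "ennreal (s powr p) * gap s \<le> ennreal (s powr p) * emeasure \<pi> ?F"
    unfolding gap_def using \<pi> by (intro mult_left_mono INF_lower) auto
  also have "\<dots> = (\<integral>\<^sup>+ z. ennreal (s powr p) * indicator ?F z \<partial>\<pi>)"
    using F by (simp add: nn_integral_cmult_indicator)
  also have "\<dots> \<le> (\<integral>\<^sup>+ z. ennreal (N (fst z - snd z) powr p) \<partial>\<pi>)"
    by (rule nn_integral_mono)
      (use assms in \<open>auto simp: indicator_def intro!: ennreal_leI powr_mono2\<close>)
  finally show "ennreal (s powr p) * gap s \<le> (\<integral>\<^sup>+ z. ennreal (N (fst z - snd z) powr p) \<partial>\<pi>)" .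
qed

text \<open>Any single coupling witnesses this at the uniform diameter bound. It makes the set
  defining \<open>critical\<close> nonempty and the costs finite.\<close>

lemma ex_gap_eq_0:
  obtains R where "0 \<le> R" "gap R = 0"
proof -
  obtain R where R: "0 \<le> R" "\<And>\<pi>. \<pi> \<in> couplings \<mu> \<nu> \<Longrightarrow> AE z in \<pi>. N (fst z - snd z) \<le> R"
    using ex_diameter by blast
  obtain \<pi> where \<pi>: "\<pi> \<in> couplings \<mu> \<nu>"
    using couplings_nonempty[OF sets fin mass] by blast
  have F: "{z::'a \<times> 'a. N (fst z - snd z) > R} \<in> sets \<pi>"
    by (rule far_measurable[OF \<pi>])
  have "emeasure \<pi> {z. N (fst z - snd z) > R} = 0"
    using AE_iff_measurable[OF F, of "\<lambda>z. N (fst z - snd z) \<le> R"] R(2)[OF \<pi>]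
    by (auto simp: coupling_space[OF \<pi>] not_le)
  moreover have "gap R \<le> emeasure \<pi> {z. N (fst z - snd z) > R}"
    unfolding gap_def using \<pi> by (rule INF_lower)
  ultimately have "gap R = 0" by simp
  with R(1) show thesis using that by blast
qed

lemma W_p_le_of_gap:
  assumes "gap t = 0" "0 \<le> t" "0 < p"
  shows "W_p N p \<mu> \<nu> \<le> total_mass powr (1 / p) * t"
proof -
  have "enn2real (cost p) \<le> total_mass * t powr p"
    using enn2real_mono[OF cost_le_of_gap[OF assms]] total_mass_nonneg by simp
  then have "W_p N p \<mu> \<nu> \<le> (total_mass * t powr p) powr (1 / p)"
    unfolding W_p_eq_cost using assms(3) by (intro powr_mono2) auto
  also have "\<dots> = total_mass powr (1 / p) * t"
    using assms total_mass_nonneg by (simp add: powr_mult powr_powr)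
  finally show ?thesis .
qed

lemma W_p_ge_gap:
  assumes "gap s \<noteq> 0" "0 \<le> s" "0 < p"
  shows "enn2real (gap s) powr (1 / p) * s \<le> W_p N p \<mu> \<nu>"
proof -
  obtain R where R: "0 \<le> R" "gap R = 0" by (rule ex_gap_eq_0)
  \<comment> \<open>\<open>enn2real\<close> sends \<open>top\<close> to 0, so it is monotone only
    below a finite bound.\<close>
  have fin_cost: "cost p < top"
    using cost_le_of_gap[OF R(2,1) assms(3)] by (rule le_less_trans) simp
  have "enn2real (ennreal (s powr p) * gap s) \<le> enn2real (cost p)"
    using cost_ge_gap[OF assms(2,3)] fin_cost by (rule enn2real_mono)
  then have "s powr p * enn2real (gap s) \<le> enn2real (cost p)"
    by (simp add: enn2real_mult)
  then have "(s powr p * enn2real (gap s)) powr (1 / p) \<le> W_p N p \<mu> \<nu>"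
    unfolding W_p_eq_cost using assms(3) by (intro powr_mono2) auto
  moreover have "(s powr p * enn2real (gap s)) powr (1 / p) = enn2real (gap s) powr (1 / p) * s"
    using assms by (simp add: powr_mult powr_powr)
  ultimately show ?thesis by simp
qed

lemma gap_finite: "gap t < top"
proof -
  obtain \<pi> where \<pi>: "\<pi> \<in> couplings \<mu> \<nu>"
    using couplings_nonempty[OF sets fin mass] by blast
  have "gap t \<le> emeasure \<pi> {z. N (fst z - snd z) > t}"
    unfolding gap_def using \<pi> by (rule INF_lower)
  also have "\<dots> \<le> ennreal total_mass" by (rule coupling_mass_le[OF \<pi>])
  finally show ?thesis by (rule le_less_trans) simp
qed

section \<open>The critical threshold and the limit of the distances\<close>

text \<open>The condition \<open>0 \<le> t\<close> keeps the set bounded below even for zero mass,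
  when \<open>gap\<close> vanishes everywhere.\<close>

definition critical :: real where "critical = Inf {t. 0 \<le> t \<and> gap t = 0}"

lemma critical_le: "0 \<le> t \<Longrightarrow> gap t = 0 \<Longrightarrow> critical \<le> t"
  unfolding critical_def by (rule cInf_lower) (auto intro: bdd_belowI[of _ 0])

lemma critical_nonneg: "0 \<le> critical"
proof -
  obtain R where "0 \<le> R" "gap R = 0" by (rule ex_gap_eq_0)
  then show ?thesis unfolding critical_def by (intro cInf_greatest) auto
qed

lemma gap_eq_0_above_critical:
  assumes "critical < t" shows "gap t = 0"
proof -
  obtain R where "0 \<le> R" "gap R = 0" by (rule ex_gap_eq_0)
  then obtain s where "0 \<le> s" "gap s = 0" "s < t"
    using assms cInf_lessD[of "{t. 0 \<le> t \<and> gap t = 0}" t] unfolding critical_def by auto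
  with gap_antimono[of s t] show ?thesis by simp
qed

text \<open>\<open>Lim\<close> is determined once convergence is shown. Below
  \<open>critical\<close> the gap is positive and above it zero, and the \<open>p\<close>-th root of
  a positive constant tends to 1, so both bounds on \<open>W_p\<close> pinch at
  \<open>critical\<close>.\<close>

lemma W_inf_eq_critical: "W_inf N \<mu> \<nu> = critical"
proof -
  have "((\<lambda>p. W_p N p \<mu> \<nu>) \<longlongrightarrow> critical) at_top"
  proof (rule order_tendstoI)
    fix a assume a: "a < critical"
    \<comment> \<open>For negative \<open>a\<close> it suffices that \<open>W_p\<close> is
      nonnegative; otherwise any \<open>s\<close> above \<open>a\<close> is nonnegative, as the
      lower bound requires.\<close>
    show "eventually (\<lambda>p. a < W_p N p \<mu> \<nu>) at_top"
    proof (cases "a < 0")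
      case True
      then show ?thesis by (intro always_eventually allI) (simp add: W_p_eq_cost less_le_trans)
    next
      case False
      obtain s where s: "a < s" "s < critical" using a dense by blast
      then have "0 \<le> s" using False by simp
      then have g: "gap s \<noteq> 0" using critical_le[of s] s by auto
      then have "0 < enn2real (gap s)" using gap_finite[of s] by (simp add: enn2real_positive_iff zero_less_iff_neq_zero)
      then have "((\<lambda>p. enn2real (gap s) powr (1 / p) * s) \<longlongrightarrow> 1 * s) at_top"
        by (intro tendsto_mult tendsto_const powr_inverse_tendsto_1)
      then have "eventually (\<lambda>p. a < enn2real (gap s) powr (1 / p) * s) at_top"
        using s by (intro order_tendstoD) auto
      then show ?thesis
        using eventually_gt_at_top[of 0]
        by eventually_elim (use W_p_ge_gap[OF g \<open>0 \<le> s\<close>] less_le_trans in blast)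
    qed
  next
    fix a assume a: "critical < a"
    obtain t where t: "critical < t" "t < a" using a dense by blast
    have t0: "0 \<le> t" using t critical_nonneg by simp
    \<comment> \<open>\<open>total_mass + 1\<close> instead of \<open>total_mass\<close>, which may be \<open>0\<close>.\<close>
    have "((\<lambda>p. (total_mass + 1) powr (1 / p) * t) \<longlongrightarrow> 1 * t) at_top"
      using total_mass_nonneg by (intro tendsto_mult tendsto_const powr_inverse_tendsto_1) auto
    then have "eventually (\<lambda>p. (total_mass + 1) powr (1 / p) * t < a) at_top"
      using t by (intro order_tendstoD) auto
    then show "eventually (\<lambda>p. W_p N p \<mu> \<nu> < a) at_top"
      using eventually_gt_at_top[of 0]
    proof eventually_elim
      case (elim p)
      have "W_p N p \<mu> \<nu> \<le> total_mass powr (1 / p) * t"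
        using W_p_le_of_gap[OF gap_eq_0_above_critical[OF t(1)] t0] elim by blast
      also have "\<dots> \<le> (total_mass + 1) powr (1 / p) * t"
        using t0 total_mass_nonneg elim by (intro mult_right_mono powr_mono2) auto
      finally show ?case using elim by simp
    qed
  qed
  then show ?thesis unfolding W_inf_def by (intro tendsto_Lim) auto
qed

text \<open>Here compactness enters. Couplings that are nearly optimal at levels \<open>t n\<close>
  decreasing to \<open>critical\<close> have a cluster point \<open>\<rho>\<close> that is optimal
  at \<open>critical\<close> itself.\<close>

lemma gap_critical: "gap critical = 0"
proof -
  define t where "t n = critical + 1 / real (Suc n)" for n
  have "\<exists>\<pi>\<in>couplings \<mu> \<nu>. emeasure \<pi> {z. N (fst z - snd z) > t n} < ennreal (1 / real (Suc n))" for n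
  proof -
    have "gap (t n) = 0" by (rule gap_eq_0_above_critical) (simp add: t_def)
    then have "gap (t n) < ennreal (1 / real (Suc n))" by simp
    then show ?thesis unfolding gap_def INF_less_iff .
  qed
  then obtain \<pi> where \<pi>: "\<And>n. \<pi> n \<in> couplings \<mu> \<nu>"
    "\<And>n. emeasure (\<pi> n) {z. N (fst z - snd z) > t n} < ennreal (1 / real (Suc n))" by metis
  obtain \<rho> where \<rho>: "\<rho> \<in> couplings \<mu> \<nu>"
    "\<And>U. open U \<Longrightarrow> (\<lambda>n. emeasure (\<pi> n) U) \<longlonglongrightarrow> 0 \<Longrightarrow> emeasure \<rho> U = 0"
    using couplings_cluster[OF sets fin, of \<pi>] \<pi>(1) by blast
  have inv: "(\<lambda>n. ennreal (1 / real (Suc n))) \<longlonglongrightarrow> 0"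
    using tendsto_ennrealI[OF LIMSEQ_inverse_real_of_nat] by (simp add: inverse_eq_divide)
  \<comment> \<open>The level \<open>t k\<close> stays fixed while \<open>n\<close> grows: for
    \<open>n \<ge> k\<close> the far set at \<open>t k\<close> is contained in the one at
    \<open>t n\<close>, whose mass under \<open>\<pi> n\<close> is below
    \<open>1 / real (Suc n)\<close>.\<close>
  have "{z. N (fst z - snd z) > t k} \<in> null_sets \<rho>" for k
  proof -
    have "(\<lambda>n. emeasure (\<pi> n) {z. N (fst z - snd z) > t k}) \<longlonglongrightarrow> 0"
    proof (rule tendsto_sandwich[OF _ _ tendsto_const inv])
      show "\<forall>\<^sub>F n in sequentially. emeasure (\<pi> n) {z. t k < N (fst z - snd z)} \<le> ennreal (1 / real (Suc n))"
        using eventually_ge_at_top[of k]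
      proof eventually_elim
        case (elim n)
        then have "t n \<le> t k" by (simp add: t_def field_simps)
        then have "emeasure (\<pi> n) {z. t k < N (fst z - snd z)} \<le> emeasure (\<pi> n) {z. t n < N (fst z - snd z)}"
          by (intro emeasure_mono) (auto intro: far_measurable \<pi>(1))
        with \<pi>(2)[of n] show ?case by simp
      qed
    qed simp
    with \<rho>(2)[OF open_far] show ?thesis
      by (intro null_setsI far_measurable \<rho>(1))
  qed
  then have "(\<Union>k. {z. N (fst z - snd z) > t k}) \<in> null_sets \<rho>" by (rule null_sets_UN)
  moreover have "(\<Union>k. {z. N (fst z - snd z) > t k}) = {z::'a \<times> 'a. N (fst z - snd z) > critical}"
  proof safe
    fix x y :: 'a and k assume "t k < N (fst (x, y) - snd (x, y))"
    then show "critical < N (fst (x, y) - snd (x, y))"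
      by (rule le_less_trans[rotated]) (simp add: t_def)
  next
    fix x y :: 'a assume "critical < N (fst (x, y) - snd (x, y))"
    then have "0 < N (fst (x, y) - snd (x, y)) - critical" by simp
    then obtain k where "1 / real (Suc k) < N (fst (x, y) - snd (x, y)) - critical"
      by (rule nat_approx_posE)
    then show "(x, y) \<in> (\<Union>k. {z. N (fst z - snd z) > t k})"
      by (auto simp: t_def intro!: exI[of _ k])
  qed
  ultimately have "emeasure \<rho> {z. N (fst z - snd z) > critical} = 0" by (simp add: null_sets_def)
  then show ?thesis
    using INF_lower[OF \<rho>(1), of "\<lambda>\<pi>. emeasure \<pi> {z. N (fst z - snd z) > critical}"] by (simp add: gap_def)
qed

end

section \<open>The equivalence\<close>

theorem theorem5:
  fixes N :: "real ^ 'd \<Rightarrow> real" and \<epsilon> :: real and \<mu> \<nu> :: "(real ^ 'd) measure"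
  assumes "is_norm N" and "\<epsilon> \<ge> 0"
    and "sets \<mu> = sets borel" and "sets \<nu> = sets borel"
    and "finite_measure \<mu>" and "finite_measure \<nu>"
    and "emeasure \<mu> UNIV = emeasure \<nu> UNIV"
    and "absolutely_continuous lborel \<mu>" and "absolutely_continuous lborel \<nu>"
    and "bounded (measure_support \<mu>)" and "bounded (measure_support \<nu>)"
  shows "D_eps N \<epsilon> \<mu> \<nu> = 0 \<longleftrightarrow> W_inf N \<mu> \<nu> \<le> 2 * \<epsilon>"
proof -
  interpret bounded_transport N \<mu> \<nu>
    by (rule bounded_transport.intro) (use assms in auto)
  show ?thesis
    unfolding D_eps_eq_gap W_inf_eq_critical
  proof
    assume "gap (2 * \<epsilon>) = 0"
    with assms(2) show "critical \<le> 2 * \<epsilon>" by (intro critical_le) auto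
  next
    \<comment> \<open>The case of equality is covered because \<open>gap\<close> vanishes at
      \<open>critical\<close> itself and not only above it.\<close>
    assume "critical \<le> 2 * \<epsilon>"
    from gap_antimono[OF this] show "gap (2 * \<epsilon>) = 0" by (simp add: gap_critical)
  qed
qed

end
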